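(* For all integers $n \geq 2$, we have $$\frac{3}{16}(n-2) \;\leq\; u(P_{n}) \;\leq\; \frac{n+1}{4},$$ where $P_n$ denotes the path on $n$ vertices.
   Context: Graphs are finite and simple. The Toucher-Isolator game on a graph $G=(V(G),E(G))$: two players, Toucher and Isolator, alternately claim previously unclaimed edges of $G$, one edge per move, with Toucher making the first move, until all edges are claimed. A vertex is touched if it is incident to at least one edge claimed by Toucher, and untouched otherwise (i.e. all of its incident edges have been claimed by Isolator). Toucher aims to minimise, and Isolator to maximise, the number of untouched vertices at the end of the game. $u(G)$ denotes the number of untouched vertices at the end of the game when both players play optimally (the minimax value of this game). *)

theory Defs
  imports Complex_Main
begin

record 'a graph =
  verts :: "'a set"
  edges :: "'a set set"

locale finite_simple_graph =
  fixes G :: "'a graph"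
  assumes finite_verts: "finite (verts G)"
    and edges_pairs: "\<And>e. e \<in> edges G \<Longrightarrow> e \<subseteq> verts G \<and> card e = 2"
begin

lemma finite_edges: "finite (edges G)"
  by (rule finite_subset[of _ "Pow (verts G)"]) (use finite_verts edges_pairs in auto)

end

definition touched :: "'a set set \<Rightarrow> 'a \<Rightarrow> bool" where
  "touched T v \<longleftrightarrow> (\<exists>e\<in>T. v \<in> e)"

definition untouched_verts :: "'a graph \<Rightarrow> 'a set set \<Rightarrow> 'a set" where
  "untouched_verts G T = {v \<in> verts G. \<not> touched T v}"

datatype player = Toucher | Isolator

text \<open>
  The minimax value of the position in which Toucher has claimed the edges in \<open>T\<close>,
  Isolator those in \<open>S\<close>, and it is the turn of \<open>p\<close>. The game is over when no edge is
  unclaimed; the additional case of infinitely many unclaimed edges is there only to make the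
  recursion terminate, and does not arise for finite graphs.
\<close>

function game_value :: "'a graph \<Rightarrow> player \<Rightarrow> 'a set set \<Rightarrow> 'a set set \<Rightarrow> nat" where
  "game_value G p T S =
    (if edges G - (T \<union> S) = {} \<or> infinite (edges G - (T \<union> S))
     then card (untouched_verts G T)
     else case p of
       Toucher \<Rightarrow> Min ((\<lambda>e. game_value G Isolator (insert e T) S) ` (edges G - (T \<union> S)))
     | Isolator \<Rightarrow> Max ((\<lambda>e. game_value G Toucher T (insert e S)) ` (edges G - (T \<union> S))))"
  by pat_completeness auto

termination
proof (relation "measure (\<lambda>(G, p, T, S). card (edges G - (T \<union> S)))", goal_cases)
  case 1
  show ?case by simp
next
  case (2 G p T S e)
  then have "card (edges G - (insert e T \<union> S)) < card (edges G - (T \<union> S))"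
    by (intro psubset_card_mono) auto
  then show ?case by simp
next
  case (3 G p T S e)
  then have "card (edges G - (T \<union> insert e S)) < card (edges G - (T \<union> S))"
    by (intro psubset_card_mono) auto
  then show ?case by simp
qed

text \<open>The defining equation loops as a rewrite rule.\<close>

declare game_value.simps [simp del]

definition untouched_number :: "'a graph \<Rightarrow> nat" where
  "untouched_number G = game_value G Toucher {} {}"

definition path_graph :: "nat \<Rightarrow> nat graph" where
  "path_graph n = \<lparr>verts = {1..n}, edges = {{i, i + 1} | i. 1 \<le> i \<and> i < n}\<rparr>"

lemma finite_simple_graph_path_graph: "finite_simple_graph (path_graph n)"
  by unfold_locales (auto simp: path_graph_def)

end

theory Submission
  imports Defs
begin

text \<open>
  Write the state of the game as a colouring of the edges of the path, adding at either end of
  the path a phantom edge that belongs to Isolator. Then a vertex ends up untouched exactly if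
  both edges at it belong to Isolator, and this holds for the two end vertices as well. Each
  bound comes from a potential, counted in quarters of a vertex, which at the end of the game
  equals four times the number of untouched vertices.

  For the upper bound the potential is the Erdos-Selfridge danger: give an edge weight 0, 1 or 2
  if it is Toucher's, unclaimed or Isolator's, and sum over the vertices the product of the two
  weights. A claim by Toucher lowers the danger by the sum of the weights of the two neighbouring
  edges, and a claim by Isolator raises it by that sum. So if Toucher always claims an unclaimed
  edge that maximises this sum, no round raises the danger (\<open>Toucher_keeps_danger\<close>). The initial
  danger is \<open>n + 2\<close>, one too many. To save one quarter, Toucher claims the first edge of the path;
  this removes 3, and now the last edge is the only one whose claim raises the danger by more
  than 2. If Isolator claims it, Toucher claims the edge next to it, which removes 3 again,
  and from then on every claim raises the danger by at most 2.

  For the lower bound the potential is the sum of a value over all gaps between consecutive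
  claimed edges. A claim splits one gap into two and affects nothing else. Besides its value
  a gap has a heat, one of 0, 2 and 3. Toucher cannot lower the value of a gap by more than its
  heat, while Isolator can raise it by the heat without creating a hotter gap. Hence, if Isolator
  always plays in a hottest gap, the next move of Toucher takes away at most what Isolator has
  just gained, and the potential never falls over such a pair of moves
  (\<open>Isolator_keeps_value\<close>). The value of a gap grows by 3/4 per edge, that is, by 3/16 of a
  vertex, and Toucher's opening move costs at most 3.
\<close>

section \<open>Positions on a path as colourings\<close>

text \<open>
  Edge \<open>i\<close> is the pair of \<open>i\<close> and \<open>i + 1\<close>. Position 0 and all positions from \<open>n\<close> on are phantom
  edges of Isolator: an end vertex of the path is untouched as soon as its only edge is
  Isolator's, just like an inner vertex whose other edge is already Isolator's.
\<close>

definition colouring :: "nat \<Rightarrow> nat set set \<Rightarrow> nat set set \<Rightarrow> nat \<Rightarrow> player option" where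
  "colouring n T S i =
    (if i = 0 \<or> n \<le> i then Some Isolator
     else if {i, Suc i} \<in> T then Some Toucher
     else if {i, Suc i} \<in> S then Some Isolator
     else None)"

lemma pair_Suc_eq_iff: "{i, Suc i} = {j, Suc j} \<longleftrightarrow> i = j"
  by (auto simp: doubleton_eq_iff)

lemma colouring_bounds:
  assumes "colouring n T S p = None"
  shows "0 < p" "p < n"
proof -
  have "p \<noteq> 0 \<and> \<not> n \<le> p"
    using assms by (metis colouring_def option.distinct(1))
  then show "0 < p" "p < n" by simp_all
qed

lemma finite_uncoloured: "finite {p. colouring n T S p = None}"
  by (rule finite_subset[of _ "{..n}"]) (auto dest: colouring_bounds)

lemma colouring_insert_Toucher:
  assumes "colouring n T S p = None"
  shows "colouring n (insert {p, Suc p} T) S = (colouring n T S)(p := Some Toucher)"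
  using assms by (auto simp: colouring_def pair_Suc_eq_iff fun_eq_iff split: if_splits)

lemma colouring_insert_Isolator:
  assumes "colouring n T S p = None"
  shows "colouring n T (insert {p, Suc p} S) = (colouring n T S)(p := Some Isolator)"
  using assms by (auto simp: colouring_def pair_Suc_eq_iff fun_eq_iff split: if_splits)

lemma unclaimed_edges_eq:
  "edges (path_graph n) - (T \<union> S) = (\<lambda>i. {i, Suc i}) ` {p. colouring n T S p = None}"
  by (auto simp: path_graph_def colouring_def)

lemma untouched_verts_eq:
  assumes "\<And>p. colouring n T S p \<noteq> None" and "T \<subseteq> edges (path_graph n)"
  shows "untouched_verts (path_graph n) T =
    {v \<in> {1..n}. colouring n T S (v - 1) = Some Isolator \<and> colouring n T S v = Some Isolator}"
proof -
  have "touched T v \<longleftrightarrow> \<not> (colouring n T S (v - 1) = Some Isolator \<and> colouring n T S v = Some Isolator)"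
    if "v \<in> {1..n}" for v
  proof -
    have "touched T v \<longleftrightarrow> (1 < v \<and> {v - 1, Suc (v - 1)} \<in> T) \<or> (v < n \<and> {v, Suc v} \<in> T)"
      (is "_ \<longleftrightarrow> ?R")
    proof
      assume "touched T v"
      then obtain e where e: "e \<in> T" "v \<in> e" by (auto simp: touched_def)
      then obtain i where i: "e = {i, Suc i}" "1 \<le> i" "i < n"
        using assms(2) by (auto simp: path_graph_def)
      with e show ?R by auto
    next
      assume ?R
      then show "touched T v" using that by (auto simp: touched_def)
    qed
    then show ?thesis
      using assms(1)[of v] assms(1)[of "v - 1"] that
      by (auto simp: colouring_def split: if_splits)
  qed
  then show ?thesis
    by (auto simp: untouched_verts_def path_graph_def)
qed

lemma game_value_full:
  assumes "\<And>p. colouring n T S p \<noteq> None" and "T \<subseteq> edges (path_graph n)"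
  shows "game_value (path_graph n) pl T S =
    card {v \<in> {1..n}. colouring n T S (v - 1) = Some Isolator \<and> colouring n T S v = Some Isolator}"
  by (subst game_value.simps)
    (use assms untouched_verts_eq[OF assms] in \<open>simp add: unclaimed_edges_eq del: not_None_eq\<close>)

lemma game_value_Toucher:
  assumes "colouring n T S q = None"
  shows "game_value (path_graph n) Toucher T S =
    Min ((\<lambda>p. game_value (path_graph n) Isolator (insert {p, Suc p} T) S) `
      {p. colouring n T S p = None})"
  using assms finite_uncoloured[of n T S]
  by (subst game_value.simps) (auto simp: unclaimed_edges_eq image_image simp del: not_None_eq)

lemma game_value_Isolator:
  assumes "colouring n T S q = None"
  shows "game_value (path_graph n) Isolator T S =
    Max ((\<lambda>p. game_value (path_graph n) Toucher T (insert {p, Suc p} S)) `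
      {p. colouring n T S p = None})"
  using assms finite_uncoloured[of n T S]
  by (subst game_value.simps) (auto simp: unclaimed_edges_eq image_image simp del: not_None_eq)

lemma game_value_Toucher_le:
  assumes "colouring n T S p = None"
  shows "game_value (path_graph n) Toucher T S
    \<le> game_value (path_graph n) Isolator (insert {p, Suc p} T) S"
  using assms finite_uncoloured[of n T S] by (simp add: game_value_Toucher)

lemma game_value_Isolator_ge:
  assumes "colouring n T S p = None"
  shows "game_value (path_graph n) Toucher T (insert {p, Suc p} S)
    \<le> game_value (path_graph n) Isolator T S"
  using assms finite_uncoloured[of n T S] by (simp add: game_value_Isolator)

lemma game_value_Toucher_attained:
  assumes "colouring n T S q = None"
  obtains p where "colouring n T S p = None"
    "game_value (path_graph n) Toucher T S
      = game_value (path_graph n) Isolator (insert {p, Suc p} T) S"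
proof -
  have "game_value (path_graph n) Toucher T S \<in>
    (\<lambda>p. game_value (path_graph n) Isolator (insert {p, Suc p} T) S) ` {p. colouring n T S p = None}"
    unfolding game_value_Toucher[OF assms] using assms finite_uncoloured[of n T S]
    by (intro Min_in) auto
  then show thesis using that by auto
qed

lemma game_value_Isolator_attained:
  assumes "colouring n T S q = None"
  obtains p where "colouring n T S p = None"
    "game_value (path_graph n) Isolator T S
      = game_value (path_graph n) Toucher T (insert {p, Suc p} S)"
proof -
  have "game_value (path_graph n) Isolator T S \<in>
    (\<lambda>p. game_value (path_graph n) Toucher T (insert {p, Suc p} S)) ` {p. colouring n T S p = None}"
    unfolding game_value_Isolator[OF assms] using assms finite_uncoloured[of n T S]
    by (intro Max_in) auto
  then show thesis using that by auto
qed

lemma edge_of_uncoloured: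
  assumes "colouring n T S p = None"
  shows "{p, Suc p} \<in> edges (path_graph n)"
  using colouring_bounds[OF assms] by (auto simp: path_graph_def)

lemma card_uncoloured_decrease:
  assumes "c p = None" and "finite {q. c q = None}"
  shows "card {q. (c(p := Some x)) q = None} < card {q. c q = None}"
  using assms by (intro psubset_card_mono) auto

section \<open>Toucher's strategy: keeping the danger low\<close>

fun danger :: "player option \<Rightarrow> nat" where
  "danger None = 1"
| "danger (Some Toucher) = 0"
| "danger (Some Isolator) = 2"

text \<open>
  Four times the expected number of untouched vertices if each unclaimed edge were given to
  either player with probability one half, independently of the others.
\<close>

definition total_danger :: "nat \<Rightarrow> (nat \<Rightarrow> player option) \<Rightarrow> nat" where
  "total_danger n c = (\<Sum>v\<in>{1..n}. danger (c (v - 1)) * danger (c v))"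

text \<open>What a claim of the unclaimed edge \<open>p\<close> adds to the danger or removes from it.\<close>

definition pressure :: "(nat \<Rightarrow> player option) \<Rightarrow> nat \<Rightarrow> nat" where
  "pressure c p = danger (c (p - 1)) + danger (c (Suc p))"

lemma total_danger_split:
  assumes "0 < p" "p < n"
  shows "total_danger n c = danger (c p) * pressure c p
    + (\<Sum>v\<in>{1..n} - {p, Suc p}. danger (c (v - 1)) * danger (c v))"
proof -
  have "{p, Suc p} \<subseteq> {1..n}" using assms by auto
  from sum.subset_diff[OF this, of "\<lambda>v. danger (c (v - 1)) * danger (c v)"] show ?thesis
    by (simp add: total_danger_def pressure_def algebra_simps)
qed

lemma total_danger_update:
  assumes "c p = None" "0 < p" "p < n"
  shows "total_danger n (c(p := x)) + pressure c p = total_danger n c + danger x * pressure c p"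
proof -
  have "(\<Sum>v\<in>{1..n} - {p, Suc p}. danger ((c(p := x)) (v - 1)) * danger ((c(p := x)) v))
      = (\<Sum>v\<in>{1..n} - {p, Suc p}. danger (c (v - 1)) * danger (c v))"
    by (rule sum.cong) (use assms in auto)
  moreover have "p - 1 \<noteq> p" using assms by simp
  then have "pressure (c(p := x)) p = pressure c p"
    by (simp add: pressure_def)
  ultimately show ?thesis
    using total_danger_split[OF assms(2,3), of c] total_danger_split[OF assms(2,3), of "c(p := x)"] assms(1)
    by simp
qed

lemma pressure_Toucher_le: "pressure (c(p := Some Toucher)) q \<le> pressure c q"
  by (simp add: pressure_def)

lemma total_danger_full:
  assumes "\<And>p. c p \<noteq> None"
  shows "total_danger n c = 4 * card {v \<in> {1..n}. c (v - 1) = Some Isolator \<and> c v = Some Isolator}"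
proof -
  have d: "danger (c p) = (if c p = Some Isolator then 2 else 0)" for p
    using assms[of p] by (cases "c p" rule: danger.cases) auto
  have "total_danger n c =
    (\<Sum>v\<in>{1..n}. if c (v - 1) = Some Isolator \<and> c v = Some Isolator then 4 else 0)"
    unfolding total_danger_def d by (rule sum.cong) auto
  then show ?thesis
    by (simp add: sum.If_cases Int_def)
qed

text \<open>
  One move of Isolator costs at most the greatest pressure on an unclaimed edge. The last
  hypothesis is the bound for the positions after that move, so that the lemma serves both inside
  the induction that proves this bound and after it.
\<close>

lemma Isolator_raises_danger:
  assumes "T \<subseteq> edges (path_graph n)"
    and pressure_le: "\<And>q. colouring n T S q = None \<Longrightarrow> pressure (colouring n T S) q \<le> M"
    and afterwards: "\<And>q. colouring n T S q = None \<Longrightarrow>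
      4 * game_value (path_graph n) Toucher T (insert {q, Suc q} S)
        \<le> total_danger n (colouring n T (insert {q, Suc q} S))"
  shows "4 * game_value (path_graph n) Isolator T S \<le> total_danger n (colouring n T S) + M"
proof (cases "\<exists>q. colouring n T S q = None")
  case False
  then show ?thesis
    using assms(1) by (simp add: game_value_full total_danger_full)
next
  case True
  then obtain q where q: "colouring n T S q = None"
    and eq: "game_value (path_graph n) Isolator T S
      = game_value (path_graph n) Toucher T (insert {q, Suc q} S)"
    using game_value_Isolator_attained by metis
  show ?thesis
    using afterwards[OF q] pressure_le[OF q] eq
      total_danger_update[of "colouring n T S" q n "Some Isolator", OF q colouring_bounds[OF q]]
    by (simp add: colouring_insert_Isolator[OF q])
qed

text \<open>
  Toucher claims an edge of maximal pressure. This creates no pressure elsewhere, so the answer of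
  Isolator restores at most the danger that Toucher has just removed.
\<close>

lemma Toucher_keeps_danger:
  assumes "T \<subseteq> edges (path_graph n)"
  shows "4 * game_value (path_graph n) Toucher T S \<le> total_danger n (colouring n T S)"
  using assms
proof (induction "card {q. colouring n T S q = None}" arbitrary: T S rule: less_induct)
  case less
  define c where "c = colouring n T S"
  show ?case
  proof (cases "\<exists>q. c q = None")
    case False
    then show ?thesis
      using less.prems by (simp add: game_value_full total_danger_full c_def)
  next
    case True
    have fin: "finite {q. c q = None}" using finite_uncoloured by (simp add: c_def)
    with True have "Max (pressure c ` {q. c q = None}) \<in> pressure c ` {q. c q = None}"
      by (intro Max_in) auto
    then obtain p where p: "c p = None" and "pressure c p = Max (pressure c ` {q. c q = None})"
      by auto
    then have max: "pressure c q \<le> pressure c p" if "c q = None" for q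
      using fin that by simp
    let ?T = "insert {p, Suc p} T"
    have c': "colouring n ?T S = c(p := Some Toucher)"
      using colouring_insert_Toucher p by (simp add: c_def)
    have T: "?T \<subseteq> edges (path_graph n)"
      using less.prems edge_of_uncoloured p by (simp add: c_def)
    have "4 * game_value (path_graph n) Isolator ?T S \<le> total_danger n (colouring n ?T S) + pressure c p"
    proof (rule Isolator_raises_danger[OF T])
      fix q assume q: "colouring n ?T S q = None"
      then show "pressure (colouring n ?T S) q \<le> pressure c p"
        using max[of q] pressure_Toucher_le[of c p q] by (auto simp: c' split: if_splits)
      have "card {r. colouring n ?T (insert {q, Suc q} S) r = None} < card {r. colouring n ?T S r = None}"
        unfolding colouring_insert_Isolator[OF q]
        using q finite_uncoloured by (rule card_uncoloured_decrease)
      also have "\<dots> < card {r. c r = None}"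
        unfolding c' using p fin by (rule card_uncoloured_decrease)
      finally show "4 * game_value (path_graph n) Toucher ?T (insert {q, Suc q} S)
          \<le> total_danger n (colouring n ?T (insert {q, Suc q} S))"
        using less.hyps T by (simp add: c_def)
    qed
    also have "\<dots> = total_danger n c"
      using total_danger_update[of c p n "Some Toucher"] colouring_bounds[of n T S p] p
      by (simp add: c' c_def)
    finally show ?thesis
      using game_value_Toucher_le[of n T S p] p by (simp add: c_def)
  qed
qed

lemma total_danger_empty:
  assumes "n \<ge> 2"
  shows "total_danger n (colouring n {} {}) = n + 2"
proof -
  have "total_danger n (colouring n {} {}) =
    (\<Sum>v\<in>{1..n}. 1) + (\<Sum>v\<in>{1..n}. if v = 1 then 1 else 0) + (\<Sum>v\<in>{1..n}. if v = n then 1 else 0)"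
    unfolding total_danger_def sum.distrib[symmetric]
    by (rule sum.cong) (use assms in \<open>auto simp: colouring_def\<close>)
  also have "\<dots> = n + 2"
    using assms by simp
  finally show ?thesis .
qed

text \<open>
  The bound \<open>n + 2\<close> that the danger gives at once is improved by one unit. From five vertices on,
  only the two outermost edges are under a pressure greater than 2, namely 3. Toucher claims
  one of them. If Isolator claims the other, the edge beside it comes under pressure 3, and this
  is the edge that Toucher claims next.
\<close>

lemma untouched_number_path_le:
  assumes "n \<ge> 2"
  shows "4 * untouched_number (path_graph n) \<le> n + 1"
proof -
  define c where "c = colouring n {} {}"
  have c: "c i = (if i = 0 \<or> n \<le> i then Some Isolator else None)" for i
    by (simp add: c_def colouring_def)
  define T where "T = {{1, Suc 1 :: nat}}"
  define c1 where "c1 = colouring n T {}"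
  have 1: "c 1 = None" using assms by (simp add: c)
  have c1: "c1 = c(1 := Some Toucher)"
    using colouring_insert_Toucher[of n "{}" "{}" 1] 1 by (simp add: c1_def c_def T_def)
  have T: "T \<subseteq> edges (path_graph n)"
    using edge_of_uncoloured[of n "{}" "{}" 1] 1 by (simp add: T_def c_def)
  have start: "untouched_number (path_graph n) \<le> game_value (path_graph n) Isolator T {}"
    unfolding untouched_number_def T_def
    by (rule game_value_Toucher_le) (use 1 in \<open>simp add: c_def\<close>)
  have D1: "total_danger n c1 + pressure c 1 = n + 2"
    using total_danger_update[of c 1 n "Some Toucher"] 1 assms total_danger_empty[OF assms]
    by (simp add: c1 c_def)
  have p1: "pressure c 1 = (if n = 2 then 4 else 3)"
    using assms by (simp add: pressure_def c)
  consider "n = 2" | "n = 3 \<or> n = 4" | "n \<ge> 5" using assms by linarith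
  then show ?thesis
  proof cases
    case 1
    have full: "colouring n T {} q \<noteq> None" for q
      unfolding c1_def[symmetric] using 1 by (simp add: c1 c)
    have "4 * game_value (path_graph n) Isolator T {} \<le> total_danger n (colouring n T {}) + 0"
      by (rule Isolator_raises_danger[OF T _ Toucher_keeps_danger[OF T]]) (use full in simp)
    then show ?thesis using start D1 p1 1 by (simp add: c1_def)
  next
    \<comment> \<open>Here \<open>n + 1\<close> and \<open>n + 2\<close> give the same bound, because \<open>untouched_number\<close> is an integer.\<close>
    case 2
    have "4 * untouched_number (path_graph n) \<le> n + 2"
      unfolding untouched_number_def total_danger_empty[OF assms, symmetric]
      by (rule Toucher_keeps_danger) simp
    then have "untouched_number (path_graph n) \<le> 1" using 2 by linarith
    then show ?thesis using 2 by linarith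
  next
    case 3
    have D1': "total_danger n c1 = n - 1" using D1 p1 3 by simp
    have "colouring n T {} 2 = None" using 3 by (simp add: c1_def[symmetric] c1 c)
    then obtain q where q: "colouring n T {} q = None"
      and eq: "game_value (path_graph n) Isolator T {}
        = game_value (path_graph n) Toucher T {{q, Suc q}}"
      using game_value_Isolator_attained by metis
    have qb: "1 < q" "q < n"
      using q colouring_bounds[OF q] by (auto simp: c1_def[symmetric] c1 split: if_splits)
    define c2 where "c2 = colouring n T {{q, Suc q}}"
    have c2: "c2 = c1(q := Some Isolator)"
      using colouring_insert_Isolator[OF q] by (simp add: c2_def c1_def)
    have D2: "total_danger n c2 = n - 1 + pressure c1 q"
      using total_danger_update[of c1 q n "Some Isolator"] q qb D1'
      by (simp add: c2_def[symmetric] c1_def[symmetric] c2)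
    show ?thesis
    proof (cases "q = n - 1")
      \<comment> \<open>Isolator has gained at most 2 after Toucher removed 3.\<close>
      case False
      then have "pressure c1 q \<le> 2"
        using qb by (auto simp: pressure_def c1 c)
      then show ?thesis
        using start Toucher_keeps_danger[OF T, of "{{q, Suc q}}"] D2 eq 3
        by (simp add: c2_def)
    next
      \<comment> \<open>Isolator has taken back all 3 at the other end, and Toucher blocks beside that edge.\<close>
      case True
      let ?p = "n - 2"
      let ?T = "insert {?p, Suc ?p} T"
      have "?p \<noteq> 0" "?p \<noteq> 1" "?p \<noteq> q" "\<not> n \<le> ?p"
        using 3 True by linarith+
      then have p: "c2 ?p = None" unfolding c2 c1 fun_upd_apply c by metis
      have c3: "colouring n ?T {{q, Suc q}} = c2(?p := Some Toucher)"
        using colouring_insert_Toucher p by (simp add: c2_def)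
      have T': "?T \<subseteq> edges (path_graph n)"
        using edge_of_uncoloured[of n T "{{q, Suc q}}" ?p] p T by (simp add: c2_def)
      have D3: "total_danger n (c2(?p := Some Toucher)) + pressure c2 ?p = n - 1 + pressure c1 q"
        using total_danger_update[of c2 ?p n "Some Toucher"] p D2 3 by simp
      have q1: "pressure c1 q = 3"
      proof -
        have "q - 1 \<noteq> 0" "q - 1 \<noteq> 1" "\<not> n \<le> q - 1"
          using 3 True by linarith+
        then have "c1 (q - 1) = None" unfolding c1 fun_upd_apply c by metis
        moreover have "c1 (Suc q) = Some Isolator" using 3 True by (simp add: c1 c)
        ultimately show ?thesis by (simp add: pressure_def)
      qed
      have bound: "4 * game_value (path_graph n) Isolator T {} \<le> total_danger n (c2(?p := Some Toucher)) + M"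
        if M: "\<And>r. (c2(?p := Some Toucher)) r = None \<Longrightarrow> pressure (c2(?p := Some Toucher)) r \<le> M" for M
      proof -
        have "4 * game_value (path_graph n) Isolator ?T {{q, Suc q}}
            \<le> total_danger n (colouring n ?T {{q, Suc q}}) + M"
          by (rule Isolator_raises_danger[OF T' _ Toucher_keeps_danger[OF T']]) (use M c3 in simp)
        then show ?thesis
          using game_value_Toucher_le[of n T "{{q, Suc q}}" ?p] p eq c3 by (simp add: c2_def)
      qed
      have p2: "pressure c2 ?p = 3"
      proof -
        have "?p - 1 \<noteq> 0" "?p - 1 \<noteq> 1" "?p - 1 \<noteq> q" "\<not> n \<le> ?p - 1"
          using 3 True by linarith+
        then have "c2 (?p - 1) = None" unfolding c2 c1 fun_upd_apply c by metis
        moreover have "Suc ?p = q" using 3 True by linarith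
        then have "c2 (Suc ?p) = Some Isolator" by (simp add: c2)
        ultimately show ?thesis by (simp add: pressure_def)
      qed
      have "pressure (c2(?p := Some Toucher)) r \<le> 2"
        if "(c2(?p := Some Toucher)) r = None" for r
      proof -
        have "1 < r" "r < n - 2"
          using that True 3 by (auto simp: c2 c1 c split: if_splits)
        then show ?thesis
          using True by (simp add: pressure_def c2 c1 c)
      qed
      then show ?thesis
        using start bound[of 2] D3 q1 p2 3 by simp
    qed
  qed
qed

section \<open>Isolator's strategy: playing in the hottest gap\<close>

text \<open>
  The value of \<open>k\<close> consecutive unclaimed edges between claimed edges of the given players, in
  quarters of a vertex. An empty gap is a single vertex with both edges claimed, so it has
  value 4 if it is untouched and 0 otherwise. The other values are about \<open>3 * k / 4\<close> plus
  a constant that depends on the ends; the constants and the rounding are what makes the two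
  inequalities \<open>gap_value_Toucher_move\<close> and \<open>gap_value_Isolator_move\<close> hold down to the shortest
  gaps. If Isolator follows the strategy, a nonempty gap between two Isolator edges occurs only
  before the first move, where it is the whole path; its value is set 3 above the bound aimed
  at, since the opening move of Toucher may cost 3.
\<close>

fun gap_value :: "player \<Rightarrow> player \<Rightarrow> nat \<Rightarrow> nat" where
  "gap_value Toucher Toucher k = (3 * k - 3) div 4"
| "gap_value Isolator Isolator k = (if k = 0 then 4 else 3 + 3 * k div 4)"
| "gap_value _ _ k = (if k = 0 then 0 else (3 * k + 6) div 4)"

text \<open>
  How urgent a gap is: a lower bound on what Isolator can gain in it, and an upper bound on
  what Toucher can take from it, again in quarters. An end held by Isolator makes a nonempty gap
  as hot as one further unclaimed edge would. Only very short gaps are cooler than 3: a single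
  edge between two Toucher edges is worthless to both players, a single edge between a Toucher
  edge and an Isolator edge becomes worth 4 or 0 from a value of 2, and two edges between Toucher
  edges become that gap after a move of Isolator.
\<close>

definition heat :: "player \<Rightarrow> player \<Rightarrow> nat \<Rightarrow> nat" where
  "heat a b k =
    (let s = k + of_bool (a = Isolator) + of_bool (b = Isolator)
     in if k = 0 \<or> s = 1 then 0 else if s = 2 then 2 else 3)"

lemma gap_value_Toucher_move:
  "gap_value a b (Suc (i + j)) \<le> gap_value a Toucher i + gap_value Toucher b j
    + heat a b (Suc (i + j))"
proof (cases a; cases b)
qed (cases i; cases j; simp add: heat_def Let_def; linarith)+

text \<open>
  Next to an Isolator edge, Isolator claims the adjacent edge and isolates a vertex at once. Between
  two Toucher edges, the third edge from one end is the right one as soon as there are four edges;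
  it threatens to isolate a vertex on either side.
\<close>

lemma gap_value_Isolator_move:
  assumes "0 < k"
  obtains i j where "Suc (i + j) = k"
    "gap_value a b k + heat a b k \<le> gap_value a Isolator i + gap_value Isolator b j"
    "heat a Isolator i \<le> heat a b k" "heat Isolator b j \<le> heat a b k"
proof -
  let ?good = "\<lambda>i j. Suc (i + j) = k
    \<and> gap_value a b k + heat a b k \<le> gap_value a Isolator i + gap_value Isolator b j
    \<and> heat a Isolator i \<le> heat a b k \<and> heat Isolator b j \<le> heat a b k"
  obtain m where k: "k = Suc m" using assms by (cases k) auto
  consider (I1) "a = Isolator" | (I2) "a = Toucher" "b = Isolator" | (TT) "a = Toucher" "b = Toucher"
    by (metis player.exhaust)
  then have "\<exists>i j. ?good i j"
  proof cases
    case I1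
    have "?good 0 m"
      unfolding I1 k by (cases b; cases m; simp add: heat_def Let_def; linarith)
    then show ?thesis by blast
  next
    case I2
    have "?good m 0"
      unfolding I2 k by (cases m; simp add: heat_def Let_def; linarith)
    then show ?thesis by blast
  next
    case TT
    consider "m = 0" | "m = 1" | "m = 2" | l where "m = Suc (Suc (Suc l))"
      by (metis One_nat_def Suc_1 not0_implies_Suc)
    then show ?thesis
    proof cases
      case 1
      have "?good 0 0" unfolding TT k 1 by (simp add: heat_def Let_def)
      then show ?thesis by blast
    next
      case 2
      have "?good 1 0" unfolding TT k 2 by (simp add: heat_def Let_def)
      then show ?thesis by blast
    next
      case 3
      have "?good 1 1" unfolding TT k 3 by (simp add: heat_def Let_def)
      then show ?thesis by blast
    next
      case 4
      have "?good 2 (Suc l)" unfolding TT k 4 by (simp add: heat_def Let_def)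
      then show ?thesis by blast
    qed
  qed
  then show thesis using that by blast
qed

text \<open>The pairs of consecutive claimed positions, including those with nothing between them.\<close>

definition gaps :: "nat \<Rightarrow> (nat \<Rightarrow> player option) \<Rightarrow> (nat \<times> nat) set" where
  "gaps n c = {(l, r). l < r \<and> r \<le> n \<and> c l \<noteq> None \<and> c r \<noteq> None \<and> (\<forall>q. l < q \<and> q < r \<longrightarrow> c q = None)}"

lemma finite_gaps: "finite (gaps n c)"
  by (rule finite_subset[of _ "{..n} \<times> {..n}"]) (auto simp: gaps_def)

lemma gaps_update:
  assumes "(l, r) \<in> gaps n c" "l < q" "q < r"
  shows "gaps n (c(q := Some x)) = insert (l, q) (insert (q, r) (gaps n c - {(l, r)}))"
proof -
  have lr: "r \<le> n" "c l \<noteq> None" "c r \<noteq> None" and between: "\<And>p. l < p \<Longrightarrow> p < r \<Longrightarrow> c p = None"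
    using assms(1) by (auto simp: gaps_def)
  show ?thesis (is "?L = ?R")
  proof (intro set_eqI iffI)
    fix z assume "z \<in> ?L"
    then obtain l' r' where z: "z = (l', r')" "l' < r'" "r' \<le> n"
      "(c(q := Some x)) l' \<noteq> None" "(c(q := Some x)) r' \<noteq> None"
      and none: "\<And>p. l' < p \<Longrightarrow> p < r' \<Longrightarrow> (c(q := Some x)) p = None"
      by (auto simp: gaps_def)
    have ends: "\<not> (l' < q \<and> q < r')" "\<not> (l' < l \<and> l < r')" "\<not> (l' < r \<and> r < r')"
      using none[of q] none[of l] none[of r] lr assms(2,3) by auto
    have outside: "p \<le> l \<or> p = q \<or> r \<le> p" if "(c(q := Some x)) p \<noteq> None" for p
      using that between[of p] by (metis fun_upd_apply linorder_not_le)
    consider "l' = q" | "r' = q" | "l' \<noteq> q" "r' \<noteq> q" by blast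
    then show "z \<in> ?R"
    proof cases
      case 1
      then have "r' = r" using outside[OF z(5)] ends z(2) assms(2,3) by linarith
      with 1 z show ?thesis by simp
    next
      case 2
      then have "l' = l" using outside[OF z(4)] ends z(2) assms(2,3) by linarith
      with 2 z show ?thesis by simp
    next
      case 3
      then have "c p = None" if "l' < p" "p < r'" for p
        using none[of p] ends that by (auto split: if_splits)
      moreover have "(l', r') \<noteq> (l, r)"
        using ends assms(2,3) by auto
      ultimately show ?thesis using 3 z by (simp add: gaps_def)
    qed
  next
    fix z assume "z \<in> ?R"
    then consider "z = (l, q)" | "z = (q, r)" | "z \<in> gaps n c" "z \<noteq> (l, r)" by blast
    then show "z \<in> ?L"
    proof cases
      case 3
      then obtain l' r' where z: "z = (l', r')" "l' < r'" "r' \<le> n" "c l' \<noteq> None" "c r' \<noteq> None"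
        and none: "\<And>p. l' < p \<Longrightarrow> p < r' \<Longrightarrow> c p = None"
        by (auto simp: gaps_def)
      have "\<not> (l' < q \<and> q < r')"
      proof
        assume "l' < q \<and> q < r'"
        then have "l' = l \<and> r' = r"
          using none[of l] none[of r] between[of l'] between[of r'] lr z assms(2,3)
          by (metis linorder_neqE_nat order.strict_trans)
        then show False using 3 z by simp
      qed
      then show ?thesis using z none by (auto simp: gaps_def)
    qed (use lr between assms(2,3) in \<open>auto simp: gaps_def\<close>)
  qed
qed

lemma gap_around:
  assumes "c p = None" "p < n" "c 0 \<noteq> None" "c n \<noteq> None"
  obtains l r where "(l, r) \<in> gaps n c" "l < p" "p < r"
proof -
  define l where "l = Max {q. q < p \<and> c q \<noteq> None}"
  define r where "r = (LEAST q. p < q \<and> c q \<noteq> None)"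
  have "p \<noteq> 0" using assms by metis
  have fin: "finite {q. q < p \<and> c q \<noteq> None}" by simp
  have l: "l < p \<and> c l \<noteq> None"
    using Max_in[OF fin] assms \<open>p \<noteq> 0\<close> unfolding l_def by fastforce
  have l': "c q = None" if "l < q" "q < p" for q
    using Max_ge[OF fin, of q] that unfolding l_def by fastforce
  have r: "p < r \<and> c r \<noteq> None"
    unfolding r_def using assms by (intro LeastI[of "\<lambda>q. p < q \<and> c q \<noteq> None" n]) auto
  have rn: "r \<le> n"
    unfolding r_def using assms by (intro Least_le) auto
  have r': "c q = None" if "p < q" "q < r" for q
    using not_less_Least[of q "\<lambda>q. p < q \<and> c q \<noteq> None"] that unfolding r_def by auto
  have "c q = None" if "l < q" "q < r" for q
    using l' r' that assms(1) by (metis linorder_neqE_nat)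
  then have "(l, r) \<in> gaps n c"
    using l r rn by (auto simp: gaps_def)
  then show thesis using that l r by blast
qed

definition total_gap_value :: "nat \<Rightarrow> (nat \<Rightarrow> player option) \<Rightarrow> nat" where
  "total_gap_value n c = (\<Sum>(l, r)\<in>gaps n c. gap_value (the (c l)) (the (c r)) (r - l - 1))"

lemma total_gap_value_update:
  assumes "(l, r) \<in> gaps n c" "l < q" "q < r" "c l = Some a" "c r = Some b"
  shows "total_gap_value n (c(q := Some x)) + gap_value a b (r - l - 1)
    = total_gap_value n c + gap_value a x (q - l - 1) + gap_value x b (r - q - 1)"
proof -
  let ?v = "\<lambda>c (l, r). gap_value (the (c l)) (the (c r)) (r - l - 1)"
  let ?c = "c(q := Some x)" and ?G = "gaps n c - {(l, r)}"
  have none: "c q = None" using assms by (auto simp: gaps_def)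
  then have notin: "(l, q) \<notin> ?G" "(q, r) \<notin> ?G" "(l, q) \<noteq> (q, r)"
    using assms(2) by (auto simp: gaps_def)
  have rest: "sum (?v ?c) ?G = sum (?v c) ?G"
  proof (intro sum.cong refl)
    fix g assume "g \<in> ?G"
    then obtain l' r' where "g = (l', r')" "c l' \<noteq> None" "c r' \<noteq> None"
      by (auto simp: gaps_def)
    then show "?v ?c g = ?v c g" using none by (cases "l' = q"; cases "r' = q"; simp)
  qed
  have "total_gap_value n ?c = ?v ?c (l, q) + (?v ?c (q, r) + sum (?v ?c) ?G)"
    unfolding total_gap_value_def gaps_update[OF assms(1-3)] using notin finite_gaps[of n c] by simp
  moreover have "total_gap_value n c = ?v c (l, r) + sum (?v c) ?G"
    unfolding total_gap_value_def using assms(1) finite_gaps[of n c] by (simp add: sum.remove)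
  ultimately show ?thesis
    using assms rest by simp
qed

text \<open>With every edge claimed, the gaps are the vertices.\<close>

lemma total_gap_value_full:
  assumes "\<And>p. c p \<noteq> None"
  shows "total_gap_value n c = 4 * card {v \<in> {1..n}. c (v - 1) = Some Isolator \<and> c v = Some Isolator}"
proof -
  have gaps: "gaps n c = (\<lambda>v. (v - 1, v)) ` {1..n}"
  proof (intro set_eqI iffI)
    fix z assume "z \<in> gaps n c"
    then obtain l r where z: "z = (l, r)" "l < r" "r \<le> n" and "\<And>q. l < q \<Longrightarrow> q < r \<Longrightarrow> c q = None"
      by (auto simp: gaps_def)
    then have "\<not> (l < Suc l \<and> Suc l < r)" using assms by metis
    then have "z = (r - 1, r)" "r \<in> {1..n}" using z by auto
    then show "z \<in> (\<lambda>v. (v - 1, v)) ` {1..n}" by blast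
  qed (use assms in \<open>auto simp: gaps_def\<close>)
  have g: "gap_value a b 0 = (if a = Isolator \<and> b = Isolator then 4 else 0)" for a b
    by (cases a; cases b) auto
  have the: "the (c p) = Isolator \<longleftrightarrow> c p = Some Isolator" for p
    using assms[of p] by auto
  have "total_gap_value n c = (\<Sum>v\<in>{1..n}. gap_value (the (c (v - 1))) (the (c v)) 0)"
    unfolding total_gap_value_def gaps by (subst sum.reindex) (auto simp: inj_on_def intro!: sum.cong)
  also have "\<dots> = (\<Sum>v\<in>{1..n}. if c (v - 1) = Some Isolator \<and> c v = Some Isolator then 4 else 0)"
    by (simp add: g the)
  finally show ?thesis
    by (simp add: sum.If_cases Int_def)
qed

definition gap_heat :: "(nat \<Rightarrow> player option) \<Rightarrow> nat \<times> nat \<Rightarrow> nat" where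
  "gap_heat c = (\<lambda>(l, r). heat (the (c l)) (the (c r)) (r - l - 1))"

lemma total_gap_value_Toucher_move:
  assumes "c p = None" "p < n" "c 0 \<noteq> None" "c n \<noteq> None"
    and heat_le: "\<And>g. g \<in> gaps n c \<Longrightarrow> gap_heat c g \<le> h"
  shows "total_gap_value n c \<le> total_gap_value n (c(p := Some Toucher)) + h"
proof -
  obtain l r where g: "(l, r) \<in> gaps n c" "l < p" "p < r"
    using gap_around[OF assms(1-4)] .
  then obtain a b where ab: "c l = Some a" "c r = Some b"
    by (auto simp: gaps_def)
  have k: "Suc ((p - l - 1) + (r - p - 1)) = r - l - 1" using g by simp
  have "gap_value a b (r - l - 1) \<le> gap_value a Toucher (p - l - 1) + gap_value Toucher b (r - p - 1) + h"
    using gap_value_Toucher_move[of a b "p - l - 1" "r - p - 1"] heat_le[OF g(1)] ab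
    unfolding k by (simp add: gap_heat_def)
  then show ?thesis
    using total_gap_value_update[OF g ab, of Toucher] by simp
qed

lemma heat_le_3: "heat a b k \<le> 3"
  by (simp add: heat_def Let_def)

text \<open>
  The bound on the heat of all gaps after the move is what limits the damage of Toucher's answer;
  it holds because Isolator chooses a hottest gap and the two new gaps are no hotter than it.
\<close>

lemma total_gap_value_Isolator_move:
  assumes "c p0 = None" "p0 < n" "c 0 \<noteq> None" "c n \<noteq> None"
  obtains p h where "c p = None" "total_gap_value n c + h \<le> total_gap_value n (c(p := Some Isolator))"
    "\<And>g. g \<in> gaps n (c(p := Some Isolator)) \<Longrightarrow> gap_heat (c(p := Some Isolator)) g \<le> h"
proof -
  let ?G = "{(l, r) \<in> gaps n c. Suc l < r}"
  have fin: "finite ?G" using finite_gaps by (rule rev_finite_subset) auto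
  obtain l0 r0 where "(l0, r0) \<in> gaps n c" "l0 < p0" "p0 < r0"
    using gap_around[OF assms] .
  then have "(l0, r0) \<in> ?G" by simp
  then have "?G \<noteq> {}" by blast
  then have "Max (gap_heat c ` ?G) \<in> gap_heat c ` ?G" using fin by (intro Max_in) auto
  then obtain l r where lr: "(l, r) \<in> gaps n c" "Suc l < r"
    and max: "gap_heat c (l, r) = Max (gap_heat c ` ?G)"
    by auto
  \<comment> \<open>The maximum was taken over nonempty gaps, but empty gaps have heat 0.\<close>
  have hottest: "gap_heat c g \<le> gap_heat c (l, r)" if "g \<in> gaps n c" for g
  proof (cases "g \<in> ?G")
    case True
    then show ?thesis using fin max by simp
  next
    case False
    then show ?thesis using that by (auto simp: gap_heat_def heat_def Let_def)
  qed
  obtain a b where ab: "c l = Some a" "c r = Some b"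
    using lr by (auto simp: gaps_def)
  have nonempty: "0 < r - l - 1" using lr by simp
  obtain i j where ij: "Suc (i + j) = r - l - 1"
    and gain: "gap_value a b (r - l - 1) + heat a b (r - l - 1)
      \<le> gap_value a Isolator i + gap_value Isolator b j"
    and cool: "heat a Isolator i \<le> heat a b (r - l - 1)" "heat Isolator b j \<le> heat a b (r - l - 1)"
    using gap_value_Isolator_move[OF nonempty, of a b] by metis
  define p where "p = Suc (l + i)"
  have p: "l < p" "p < r" "p - l - 1 = i" "r - p - 1 = j"
    using ij by (auto simp: p_def)
  have none: "c p = None" using lr p by (auto simp: gaps_def)
  show thesis
  proof (rule that[of p "gap_heat c (l, r)"])
    show "total_gap_value n c + gap_heat c (l, r) \<le> total_gap_value n (c(p := Some Isolator))"
      using total_gap_value_update[OF lr(1) p(1,2) ab, of Isolator] gain p(3,4) ab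
      by (simp add: gap_heat_def)
    fix g assume "g \<in> gaps n (c(p := Some Isolator))"
    then consider "g = (l, p)" | "g = (p, r)" | "g \<in> gaps n c"
      unfolding gaps_update[OF lr(1) p(1,2)] by blast
    then show "gap_heat (c(p := Some Isolator)) g \<le> gap_heat c (l, r)"
    proof cases
      case 1
      then show ?thesis using p ab cool by (simp add: gap_heat_def)
    next
      case 2
      then show ?thesis using p ab cool by (simp add: gap_heat_def)
    next
      case 3
      then obtain l' r' where "g = (l', r')" "c l' \<noteq> None" "c r' \<noteq> None"
        by (auto simp: gaps_def)
      then have "gap_heat (c(p := Some Isolator)) g = gap_heat c g"
        using none by (cases "l' = p"; cases "r' = p"; simp add: gap_heat_def)
      then show ?thesis using hottest[OF 3] by simp
    qed
  qed (rule none)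
qed

lemma colouring_ends: "colouring n T S 0 \<noteq> None" "colouring n T S n \<noteq> None"
  by (simp_all add: colouring_def)

text \<open>
  The inductive step spans Isolator's move and Toucher's answer. If Isolator's move
  is the last of the game, its gain is simply kept.
\<close>

lemma Isolator_keeps_value:
  assumes "T \<subseteq> edges (path_graph n)"
  shows "total_gap_value n (colouring n T S) \<le> 4 * game_value (path_graph n) Isolator T S"
  using assms
proof (induction "card {q. colouring n T S q = None}" arbitrary: T S rule: less_induct)
  case less
  define c where "c = colouring n T S"
  show ?case
  proof (cases "\<exists>q. c q = None")
    case False
    then show ?thesis
      using less.prems by (simp add: game_value_full total_gap_value_full c_def)
  next
    case True
    then obtain p0 where p0: "c p0 = None" by blast
    obtain p h where p: "c p = None"
      and gain: "total_gap_value n c + h \<le> total_gap_value n (c(p := Some Isolator))"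
      and heat_le: "\<And>g. g \<in> gaps n (c(p := Some Isolator)) \<Longrightarrow> gap_heat (c(p := Some Isolator)) g \<le> h"
      using total_gap_value_Isolator_move[of c p0 n] p0 colouring_bounds(2)[of n T S p0] colouring_ends[of n T S]
      unfolding c_def by metis
    let ?S = "insert {p, Suc p} S"
    have c': "colouring n T ?S = c(p := Some Isolator)"
      using colouring_insert_Isolator p by (simp add: c_def)
    have "total_gap_value n c \<le> 4 * game_value (path_graph n) Toucher T ?S"
    proof (cases "\<exists>q. colouring n T ?S q = None")
      case False
      then have "4 * game_value (path_graph n) Toucher T ?S = total_gap_value n (colouring n T ?S)"
        using less.prems by (simp add: game_value_full total_gap_value_full)
      then show ?thesis using gain by (simp add: c')
    next
      case True
      then obtain q where q: "colouring n T ?S q = None"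
        and eq: "game_value (path_graph n) Toucher T ?S
          = game_value (path_graph n) Isolator (insert {q, Suc q} T) ?S"
        using game_value_Toucher_attained by metis
      let ?T = "insert {q, Suc q} T"
      have "card {r. colouring n ?T ?S r = None} < card {r. colouring n T ?S r = None}"
        unfolding colouring_insert_Toucher[OF q]
        using q finite_uncoloured by (rule card_uncoloured_decrease)
      also have "\<dots> < card {r. c r = None}"
        unfolding c' using p finite_uncoloured[of n T S, folded c_def] by (rule card_uncoloured_decrease)
      finally have IH: "total_gap_value n (colouring n ?T ?S) \<le> 4 * game_value (path_graph n) Isolator ?T ?S"
        using less.hyps less.prems edge_of_uncoloured[OF q] by (simp add: c_def)
      have "total_gap_value n (colouring n T ?S) \<le> total_gap_value n (colouring n ?T ?S) + h"
        unfolding colouring_insert_Toucher[OF q]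
        by (rule total_gap_value_Toucher_move[OF q colouring_bounds(2)[OF q] colouring_ends])
          (simp only: c' heat_le)
      then show ?thesis using IH eq gain by (simp add: c')
    qed
    then show ?thesis
      using game_value_Isolator_ge[of n T S p] p by (simp add: c_def)
  qed
qed

lemma total_gap_value_empty:
  assumes "n \<ge> 2"
  shows "total_gap_value n (colouring n {} {}) = 3 + 3 * (n - 1) div 4"
proof -
  have "gaps n (colouring n {} {}) = {(0, n)}"
    using assms by (auto simp: gaps_def colouring_def split: if_splits)
  then show ?thesis
    using assms by (simp add: total_gap_value_def colouring_def)
qed

text \<open>
  Toucher's opening move costs at most 3, the greatest possible heat, and afterwards Isolator is to
  move.
\<close>

lemma untouched_number_path_ge:
  assumes "n \<ge> 2"
  shows "3 * (n - 1) div 4 \<le> 4 * untouched_number (path_graph n)"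
proof -
  have "colouring n {} {} 1 = None" using assms by (simp add: colouring_def)
  then obtain p where p: "colouring n {} {} p = None"
    and eq: "untouched_number (path_graph n) = game_value (path_graph n) Isolator {{p, Suc p}} {}"
    unfolding untouched_number_def using game_value_Toucher_attained by metis
  have "total_gap_value n (colouring n {} {}) \<le> total_gap_value n (colouring n {{p, Suc p}} {}) + 3"
    unfolding colouring_insert_Toucher[OF p]
    by (rule total_gap_value_Toucher_move[OF p colouring_bounds(2)[OF p] colouring_ends])
      (simp add: gap_heat_def heat_le_3 split: prod.splits)
  then show ?thesis
    using Isolator_keeps_value[of "{{p, Suc p}}" n "{}"] edge_of_uncoloured[OF p] eq
      total_gap_value_empty[OF assms] by simp
qed

theorem theorem1p4:
  fixes n :: nat
  assumes "n \<ge> 2"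
  shows "3 / 16 * (real n - 2) \<le> real (untouched_number (path_graph n))
    \<and> real (untouched_number (path_graph n)) \<le> (real n + 1) / 4"
proof -
  \<comment> \<open>Rounding down \<open>3 * (n - 1) / 4\<close> loses at most 3/4, which is why \<open>n - 2\<close> appears.\<close>
  have "3 * n \<le> 16 * untouched_number (path_graph n) + 6"
    using untouched_number_path_ge[OF assms] assms by linarith
  moreover have "4 * untouched_number (path_graph n) \<le> n + 1"
    by (rule untouched_number_path_le[OF assms])
  ultimately have "3 * real n \<le> 16 * real (untouched_number (path_graph n)) + 6"
    and "4 * real (untouched_number (path_graph n)) \<le> real n + 1"
    by linarith+
  then show ?thesis by (simp add: field_simps)
qed

end
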